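(* (In ZFC) There exists a MAD family on $\omega$ that is not fin-intersecting.
   Context: An almost disjoint family on $\omega$ is an infinite set $\mathcal A$ of infinite subsets of $\omega$ such that $a\cap b$ is finite for all distinct $a,b\in\mathcal A$; it is MAD if it is not properly contained in any other almost disjoint family on $\omega$. A fin sequence is a function $C:\omega\to[\omega]^{<\omega}\setminus\{\emptyset\}$ with $C(n)\cap C(m)=\emptyset$ whenever $n\neq m$. A collection of sets is centered if every finite nonempty subcollection has infinite intersection. An almost disjoint family $\mathcal A$ is fin-intersecting if for every fin sequence $C$ there exists an infinite $I\subseteq\omega$ such that $\{\{n\in I: a\cap C(n)\neq\emptyset\}: a\in\mathcal A\}\setminus[I]^{<\omega}$ is centered, where $[I]^{<\omega}$ is the set of finite subsets of $I$. *)

theory Defs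
  imports Main
begin

definition almost_disjoint_family :: "nat set set \<Rightarrow> bool" where
  "almost_disjoint_family \<A> \<longleftrightarrow>
     infinite \<A> \<and> (\<forall>a\<in>\<A>. infinite a) \<and> (\<forall>a\<in>\<A>. \<forall>b\<in>\<A>. a \<noteq> b \<longrightarrow> finite (a \<inter> b))"

definition MAD_family :: "nat set set \<Rightarrow> bool" where
  "MAD_family \<A> \<longleftrightarrow>
     almost_disjoint_family \<A> \<and> \<not> (\<exists>\<B>. almost_disjoint_family \<B> \<and> \<A> \<subset> \<B>)"

definition fin_sequence :: "(nat \<Rightarrow> nat set) \<Rightarrow> bool" where
  "fin_sequence C \<longleftrightarrow>
     (\<forall>n. finite (C n) \<and> C n \<noteq> {}) \<and> (\<forall>n m. n \<noteq> m \<longrightarrow> C n \<inter> C m = {})"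

definition centered :: "'a set set \<Rightarrow> bool" where
  "centered \<C> \<longleftrightarrow> (\<forall>\<F>. \<F> \<subseteq> \<C> \<and> finite \<F> \<and> \<F> \<noteq> {} \<longrightarrow> infinite (\<Inter>\<F>))"

definition fin_intersecting :: "nat set set \<Rightarrow> bool" where
  "fin_intersecting \<A> \<longleftrightarrow>
     (\<forall>C. fin_sequence C \<longrightarrow>
       (\<exists>I. infinite I \<and>
         centered ((\<lambda>a. {n \<in> I. a \<inter> C n \<noteq> {}}) ` \<A> - {J. J \<subseteq> I \<and> finite J})))"

end

theory Submission
  imports Defs "HOL-Library.Nat_Bijection" "HOL-Library.Infinite_Set"
begin

text \<open>
  Code finite sets of naturals by naturals, and let \<open>C n\<close> be the set of codes of the finite sets with
  maximum \<open>n\<close>. Each infinite \<open>D\<close> gives a branch of the tree of finite sets under end extension: the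
  codes of its initial segments. Two different infinite sets share only finitely many initial
  segments, so the branches form an almost disjoint family, and Zorn's lemma puts them into a MAD
  family. The branch of \<open>D\<close> meets \<open>C n\<close> exactly when \<open>n \<in> D\<close>, so every infinite set of naturals occurs
  as the trace of a member of the family on the fin sequence \<open>C\<close>. Hence no infinite \<open>I\<close> can be a
  witness for \<open>C\<close>: splitting \<open>I\<close> into two infinite halves yields two infinite traces on \<open>I\<close> that are
  disjoint.
\<close>

lemma almost_disjoint_family_extends_to_MAD:
  assumes "almost_disjoint_family \<A>"
  obtains \<M> where "\<A> \<subseteq> \<M>" and "MAD_family \<M>"
proof -
  define P where "P = {\<B>. \<A> \<subseteq> \<B> \<and> almost_disjoint_family \<B>}"
  have "\<Union>\<K> \<in> P" if "\<K> \<noteq> {}" and chain: "subset.chain P \<K>" for \<K>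
  proof -
    have KP: "\<K> \<subseteq> P" using chain by (auto simp: subset.chain_def)
    then have sub: "\<A> \<subseteq> \<Union>\<K>" using \<open>\<K> \<noteq> {}\<close> by (auto simp: P_def)
    have "infinite (\<Union>\<K>)"
      using sub assms by (meson almost_disjoint_family_def infinite_super)
    moreover have "\<forall>a\<in>\<Union>\<K>. infinite a"
      using KP by (auto simp: P_def almost_disjoint_family_def)
    moreover have "finite (a \<inter> b)" if ab: "a \<in> \<Union>\<K>" "b \<in> \<Union>\<K>" "a \<noteq> b" for a b
    proof -
      obtain \<B> where "\<B> \<in> \<K>" "a \<in> \<B>" "b \<in> \<B>"
        using ab chain unfolding subset_chain_def by blast
      then show ?thesis
        using KP \<open>a \<noteq> b\<close> unfolding P_def almost_disjoint_family_def by blast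
    qed
    ultimately show ?thesis
      using sub by (auto simp: P_def almost_disjoint_family_def)
  qed
  moreover have "P \<noteq> {}" using assms by (auto simp: P_def)
  ultimately obtain \<M> where "\<M> \<in> P" and max: "\<forall>\<B>\<in>P. \<M> \<subseteq> \<B> \<longrightarrow> \<B> = \<M>"
    using subset_Zorn_nonempty by metis
  show thesis
  proof
    show "\<A> \<subseteq> \<M>" using \<open>\<M> \<in> P\<close> by (simp add: P_def)
    show "MAD_family \<M>"
      using \<open>\<M> \<in> P\<close> max unfolding MAD_family_def P_def by blast
  qed
qed

definition codes_with_max :: "nat \<Rightarrow> nat set" where
  "codes_with_max n = set_encode ` {s. s \<subseteq> {..n} \<and> n \<in> s}"

text \<open>
  Only the initial segments that end in an element of \<open>D\<close> are coded, so the maximum of a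
  segment tells where it was cut.
\<close>

definition branch :: "nat set \<Rightarrow> nat set" where
  "branch D = (\<lambda>n. set_encode (D \<inter> {..n})) ` D"

lemma fin_sequence_codes_with_max: "fin_sequence codes_with_max"
proof -
  have "codes_with_max n \<inter> codes_with_max m = {}" if "n \<noteq> m" for n m
  proof -
    have "set_encode s \<noteq> set_encode t"
      if "s \<subseteq> {..n}" "n \<in> s" "t \<subseteq> {..m}" "m \<in> t" for s t
    proof -
      have "finite s" "finite t" using that finite_subset[OF _ finite_atMost] by blast+
      moreover have "s \<noteq> t" using that \<open>n \<noteq> m\<close> by (metis atMost_iff le_antisym subsetD)
      ultimately show ?thesis by (simp add: set_encode_eq)
    qed
    then show ?thesis unfolding codes_with_max_def by blast
  qed
  moreover have "finite (codes_with_max n)" for n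
    unfolding codes_with_max_def by simp
  moreover have "codes_with_max n \<noteq> {}" for n
    unfolding codes_with_max_def by blast
  ultimately show ?thesis
    unfolding fin_sequence_def by blast
qed

lemma branch_meets_codes_with_max_iff: "branch D \<inter> codes_with_max n \<noteq> {} \<longleftrightarrow> n \<in> D"
proof
  assume "branch D \<inter> codes_with_max n \<noteq> {}"
  then obtain m s where "m \<in> D" "s \<subseteq> {..n}" "n \<in> s" "set_encode (D \<inter> {..m}) = set_encode s"
    unfolding branch_def codes_with_max_def by blast
  then have "D \<inter> {..m} = s" using finite_subset[of s "{..n}"] by (simp add: set_encode_eq)
  then show "n \<in> D" using \<open>n \<in> s\<close> by blast
next
  assume "n \<in> D"
  then show "branch D \<inter> codes_with_max n \<noteq> {}"
    unfolding branch_def codes_with_max_def by blast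
qed

lemma inj_branch: "inj branch"
  by (rule injI) (metis branch_meets_codes_with_max_iff set_eqI)

lemma infinite_branch:
  assumes "infinite D"
  shows "infinite (branch D)"
proof -
  have "inj_on (\<lambda>n. set_encode (D \<inter> {..n})) D"
    by (rule inj_onI) (auto simp: set_encode_eq intro: antisym)
  then show ?thesis using assms unfolding branch_def by (simp add: finite_image_iff)
qed

text \<open>
  If \<open>k\<close> lies in exactly one of \<open>D\<close> and \<open>E\<close>, then a common initial segment must be cut below \<open>k\<close>.
\<close>

lemma finite_branch_Int_branch:
  assumes "D \<noteq> E"
  shows "finite (branch D \<inter> branch E)"
proof -
  obtain k where k: "k \<in> D \<longleftrightarrow> k \<notin> E" using assms by blast
  have "branch D \<inter> branch E \<subseteq> set_encode ` Pow {..k}"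
  proof
    fix x assume "x \<in> branch D \<inter> branch E"
    then obtain n m where nm: "n \<in> D" "m \<in> E" "x = set_encode (D \<inter> {..n})"
        "set_encode (D \<inter> {..n}) = set_encode (E \<inter> {..m})"
      unfolding branch_def by blast
    then have eq: "D \<inter> {..n} = E \<inter> {..m}" by (simp add: set_encode_eq)
    then have "n = m" using nm(1,2) by (metis Int_iff antisym atMost_iff order_refl)
    then have "n < k" using eq k by (metis Int_iff atMost_iff linorder_not_less)
    then show "x \<in> set_encode ` Pow {..k}" using nm(3) by auto
  qed
  then show ?thesis by (rule finite_subset) simp
qed

lemma almost_disjoint_family_branches: "almost_disjoint_family (branch ` {D. infinite D})"
proof -
  have "infinite (range (atLeast :: nat \<Rightarrow> nat set))"
    by (rule range_inj_infinite) (simp add: inj_def)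
  moreover have "range (atLeast :: nat \<Rightarrow> nat set) \<subseteq> {D. infinite D}"
    by (auto simp: infinite_Ici)
  ultimately have "infinite {D :: nat set. infinite D}" by (rule infinite_super[rotated])
  then have "infinite (branch ` {D. infinite D})"
    using inj_branch by (meson finite_imageD inj_on_subset subset_UNIV)
  moreover have "finite (branch D \<inter> branch E)" if "branch D \<noteq> branch E" for D E
    using that by (metis finite_branch_Int_branch)
  ultimately show ?thesis
    using infinite_branch by (simp add: almost_disjoint_family_def)
qed

theorem corollary23: "\<exists>\<A>. MAD_family \<A> \<and> \<not> fin_intersecting \<A>"
proof -
  obtain \<M> where sub: "branch ` {D. infinite D} \<subseteq> \<M>" and MAD: "MAD_family \<M>"
    using almost_disjoint_family_extends_to_MAD[OF almost_disjoint_family_branches] .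
  have "\<not> fin_intersecting \<M>"
  proof
    assume "fin_intersecting \<M>"
    then obtain I where "infinite I" and cent:
        "centered ((\<lambda>a. {n \<in> I. a \<inter> codes_with_max n \<noteq> {}}) ` \<M> - {J. J \<subseteq> I \<and> finite J})"
          (is "centered ?T")
      using fin_sequence_codes_with_max unfolding fin_intersecting_def by blast
    have trace: "J \<in> ?T" if "J \<subseteq> I" "infinite J" for J
    proof -
      have "J = {n \<in> I. branch J \<inter> codes_with_max n \<noteq> {}}"
        using \<open>J \<subseteq> I\<close> by (auto simp: branch_meets_codes_with_max_iff)
      moreover have "branch J \<in> \<M>" using sub \<open>infinite J\<close> by blast
      ultimately show ?thesis using \<open>infinite J\<close> by blast
    qed
    obtain D E where "D \<subseteq> I" "E \<subseteq> I" "infinite D" "infinite E" and disj: "D \<inter> E = {}"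
      using infinite_split[OF \<open>infinite I\<close>] .
    then have "{D, E} \<subseteq> ?T" using trace by blast
    then have "infinite (\<Inter>{D, E})"
      using cent unfolding centered_def by (meson finite.intros insert_not_empty)
    then show False using disj by simp
  qed
  with MAD show ?thesis by blast
qed

end
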